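(* There exists $C>0$, possibly depending on $n$ (and on nothing else), such that the following holds. Let $\lambda\ge1$ and $R,r>0$ be such that $$\lambda R\ge r>0.$$ Then for all measurable $E\subseteq\mathbb{R}^n$ with $$\frac{\mathcal{L}^n(E\cap B_R)}{\mathcal{L}^n(B_R)}\le\frac12,$$ there holds $$\Big(\mathcal{L}^n(E\cap B_R)\Big)^{\frac{n-1}{n}}\le C\lambda\,\mathrm{Per}_r(E,B_R).$$
   Context: $B_\rho(x)$ is the ball of radius $\rho$ centered at $x$ in $\mathbb{R}^n$, $B_\rho:=B_\rho(0)$, and $\mathcal{L}^n$ is the $n$-dimensional Lebesgue measure. For $A\subseteq\mathbb{R}^n$, $A\oplus B_r:=\bigcup_{x\in A}B_r(x)$. Measurable sets are identified with their sets of points of density one, and $\partial E$ denotes the topological boundary of the set of points of density one of $E$. For a domain $\Omega$ and measurable $E\subseteq\mathbb{R}^n$, $$\mathrm{Per}_r(E,\Omega):=\frac{1}{2r}\mathcal{L}^n\Big(\big((\partial E)\oplus B_r\big)\cap\Omega\Big).$$ When $n=1$ and $\mathcal{L}^n(E\cap B_R)=0$, the left-hand side of the inequality is understood to be $0$. *)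

theory Defs
  imports "HOL-Analysis.Analysis"
begin

definition density_one_points :: "'a::euclidean_space set \<Rightarrow> 'a set" where
  "density_one_points E =
     {x. ((\<lambda>\<rho>. measure lebesgue (E \<inter> ball x \<rho>) / measure lebesgue (ball x \<rho>)) \<longlongrightarrow> 1) (at_right 0)}"

text \<open>The boundary is taken after replacing the set by its points of density one, so it does not
  depend on the Lebesgue representative.\<close>

definition density_boundary :: "'a::euclidean_space set \<Rightarrow> 'a set" where
  "density_boundary E = frontier (density_one_points E)"

definition fattening :: "'a::metric_space set \<Rightarrow> real \<Rightarrow> 'a set" where
  "fattening A r = (\<Union>x\<in>A. ball x r)"

text \<open>The value is an extended nonnegative real, since \<open>\<Omega>\<close> may have infinite measure.\<close>

definition Per :: "real \<Rightarrow> 'a::euclidean_space set \<Rightarrow> 'a set \<Rightarrow> ennreal" where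
  "Per r E \<Omega> = emeasure lebesgue (fattening (density_boundary E) r \<inter> \<Omega>) / ennreal (2 * r)"

text \<open>In dimension one the relative isoperimetric inequality has a left-hand side of the form
  \<open>m powr 0\<close>, understood to be \<open>0\<close> for \<open>m = 0\<close>. This is the value of \<open>0 powr 0\<close> in HOL.\<close>

end

theory Submission
  imports Defs
begin

text \<open>
  The inequality is local at heart. Write \<open>n\<close> for the dimension, \<open>K\<close> for the ball of radius \<open>R\<close> about
  the origin, \<open>F\<close> for the \<open>r\<close>-fattening of the boundary and \<open>m\<close> for the measure of \<open>E \<inter> K\<close>. Shrinking
  \<open>r\<close> to \<open>min r R\<close> costs at most the factor \<open>l\<close>, so let \<open>r \<le> R\<close>.

  The main step is that about every density point \<open>x\<close> of \<open>E\<close> in \<open>K\<close> there is a ball of some radius \<open>\<rho>\<close>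
  with \<open>c * r * \<rho> ^ (n - 1) \<le> measure (F \<inter> K \<inter> ball x \<rho>)\<close> (\<open>fattened_boundary_in_ball_ge\<close>). Halving
  the radius from \<open>2 * R\<close>, where \<open>E\<close> fills at most half of \<open>K\<close>, one reaches a scale \<open>\<rho>\<close> at which both
  \<open>E\<close> and its complement occupy a fixed fraction of the convex set \<open>D = K \<inter> ball x \<rho>\<close>
  (\<open>balanced_ball\<close>). Every segment from a point of \<open>E\<close> to a point of the complement crosses the
  boundary, and so spends a proportion of its length of order at least \<open>r / \<rho>\<close> inside \<open>F\<close>.
  Integrating over all pairs of end points turns this into a lower bound for the measure of \<open>F \<inter> D\<close>
  (\<open>relative_isoperimetric_product\<close>).

  These balls are then combined by Vitali's covering lemma. If one of the radii is at least
  \<open>S = m powr (1 / n)\<close>, its ball alone suffices. Otherwise \<open>\<rho> ^ n \<le> S * \<rho> ^ (n - 1)\<close> for all of them, so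
  the volume of each five times enlarged ball is at most a multiple of \<open>S / r\<close> times the measure of
  \<open>F \<inter> K\<close> inside the original ball; summing over a disjoint subfamily whose enlargements cover
  \<open>E \<inter> K\<close> up to a null set gives \<open>m \<le> const * S / r * measure (F \<inter> K)\<close>, and
  \<open>m / S = m powr ((n - 1) / n)\<close>.

  The boundary is that of the set of density one points, so the Lebesgue density theorem is needed
  to compare this set with \<open>E\<close>. In the geometric part the two sets enter only through their closures:
  the closure \<open>P\<close> of the density points and the closure \<open>Q\<close> of the remaining points are closed, cover
  the space, and meet exactly in the boundary.
\<close>

section \<open>Covering arguments and the Lebesgue density theorem\<close>

text \<open>
  How disjointness is used in a covering argument: each covering set is charged to a piece of \<open>H\<close>,
  and no part of \<open>H\<close> is charged twice.
\<close>

lemma emeasure_UN_le_disjoint: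
  assumes C: "countable C" and disj: "disjoint_family_on G C"
    and A: "\<And>i. i \<in> C \<Longrightarrow> A i \<in> sets M" and G: "\<And>i. i \<in> C \<Longrightarrow> G i \<in> sets M"
    and H: "H \<in> sets M" "\<And>i. i \<in> C \<Longrightarrow> G i \<subseteq> H"
    and le: "\<And>i. i \<in> C \<Longrightarrow> emeasure M (A i) \<le> k * emeasure M (G i)"
  shows "emeasure M (\<Union>i\<in>C. A i) \<le> k * emeasure M H"
proof -
  \<comment> \<open>Both families are reindexed by the natural numbers, padded with empty sets.\<close>
  define idx where "idx = (\<lambda>m. from_nat_into C m)"
  define A' where "A' m = (if m \<in> to_nat_on C ` C then A (idx m) else {})" for m
  define G' where "G' m = (if m \<in> to_nat_on C ` C then G (idx m) else {})" for m
  have idx: "idx (to_nat_on C i) = i" if "i \<in> C" for i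
    using that C by (simp add: idx_def)
  have "(\<Union>i\<in>C. A i) = (\<Union>m. A' m)"
    unfolding A'_def using idx by (auto split: if_splits)
  moreover have A': "range A' \<subseteq> sets M" and G': "range G' \<subseteq> sets M"
    using A G idx by (auto simp: A'_def G'_def)
  moreover have dG: "disjoint_family G'"
    unfolding disjoint_family_on_def
  proof clarify
    fix m n :: nat assume "m \<noteq> n"
    show "G' m \<inter> G' n = {}"
    proof (cases "m \<in> to_nat_on C ` C \<and> n \<in> to_nat_on C ` C")
      case True
      then obtain i j where "i \<in> C" "j \<in> C" "m = to_nat_on C i" "n = to_nat_on C j" by blast
      moreover from this have "G i \<inter> G j = {}"
        using disj \<open>m \<noteq> n\<close> by (metis disjoint_family_onD)
      ultimately show ?thesis
        by (simp add: G'_def idx)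
    qed (auto simp: G'_def)
  qed
  ultimately have "emeasure M (\<Union>i\<in>C. A i) \<le> (\<Sum>m. emeasure M (A' m))"
    using emeasure_subadditive_countably[of A' M] by simp
  also have "\<dots> \<le> (\<Sum>m. k * emeasure M (G' m))"
    using le idx by (intro suminf_le) (auto simp: A'_def G'_def)
  also have "\<dots> = k * (\<Sum>m. emeasure M (G' m))"
    by simp
  also have "(\<Sum>m. emeasure M (G' m)) = emeasure M (\<Union>m. G' m)"
    using G' dG by (rule suminf_emeasure)
  also have "k * emeasure M (\<Union>m. G' m) \<le> k * emeasure M H"
    using H idx by (intro mult_left_mono emeasure_mono) (auto simp: G'_def split: if_splits)
  finally show ?thesis .
qed

text \<open>
  Vitali's covering lemma in the form of a comparison of measures: a local inequality between a set
  \<open>G\<close> in a ball and the volume of the enlarged ball becomes a global one, with the same constant.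
\<close>

lemma emeasure_le_Vitali:
  fixes X G :: "'a::euclidean_space set"
  assumes \<rho>: "\<And>x. x \<in> X \<Longrightarrow> 0 < \<rho> x \<and> \<rho> x \<le> b"
    and X: "X \<in> sets lebesgue" and G: "G \<in> sets lebesgue"
    and le: "\<And>x. x \<in> X \<Longrightarrow> emeasure lebesgue (ball x (5 * \<rho> x)) \<le> k * emeasure lebesgue (G \<inter> ball x (\<rho> x))"
  shows "emeasure lebesgue X \<le> k * emeasure lebesgue G"
proof -
  have "X \<subseteq> (\<Union>x\<in>X. ball x (\<rho> x))"
    using \<rho> by auto
  then obtain C where C: "countable C" "C \<subseteq> X"
    "pairwise (\<lambda>x y. disjnt (ball x (\<rho> x)) (ball y (\<rho> y))) C" "X \<subseteq> (\<Union>x\<in>C. ball x (5 * \<rho> x))"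
    by (rule Vitali_covering_lemma_balls[where a = "\<lambda>x. x" and r = \<rho> and K = X and B = b])
      (use \<rho> in blast)+
  have "emeasure lebesgue X \<le> emeasure lebesgue (\<Union>x\<in>C. ball x (5 * \<rho> x))"
    using C by (intro emeasure_mono) auto
  also have "\<dots> \<le> k * emeasure lebesgue G"
  proof (rule emeasure_UN_le_disjoint[where G = "\<lambda>x. G \<inter> ball x (\<rho> x)"])
    show "disjoint_family_on (\<lambda>x. G \<inter> ball x (\<rho> x)) C"
      using C(3) unfolding disjoint_family_on_def pairwise_def disjnt_def by blast
  qed (use C G le in auto)
  finally show ?thesis .
qed

lemma measure_Diff_eq:
  assumes "D \<in> fmeasurable M" "E \<in> sets M"
  shows "measure M (D - E) = measure M D - measure M (E \<inter> D)"
proof -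
  have "D - E = D - E \<inter> D" by auto
  moreover have "E \<inter> D \<in> fmeasurable M"
    using assms by (metis Int_commute fmeasurable_Int_fmeasurable)
  ultimately show ?thesis
    using assms measurable_measure_Diff[of D M "E \<inter> D"] by (simp add: fmeasurableD)
qed

text \<open>
  The balls in which \<open>E\<close> misses a proportion \<open>e\<close> form a Vitali cover of \<open>N\<close> inside any open
  superset \<open>T\<close> of \<open>E\<close>. A disjoint subfamily covers almost all of \<open>N\<close>, while its total volume is at most
  \<open>1 / e\<close> times the measure of \<open>T - E\<close>, which can be made arbitrarily small.
\<close>

lemma negligible_persistent_deficit:
  fixes E :: "'a::euclidean_space set"
  assumes E: "E \<in> sets lebesgue" and "N \<subseteq> E" and e: "e > 0"
    and deficit: "\<And>x d. x \<in> N \<Longrightarrow> d > 0 \<Longrightarrow>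
      \<exists>\<rho>. 0 < \<rho> \<and> \<rho> < d \<and> measure lebesgue (ball x \<rho>) * e \<le> measure lebesgue (ball x \<rho> - E)"
  shows "negligible N"
  unfolding negligible_outer_le
proof (intro allI impI)
  fix \<delta> :: real assume \<delta>: "\<delta> > 0"
  obtain T where T: "open T" "E \<subseteq> T" "T - E \<in> lmeasurable" "emeasure lebesgue (T - E) < ennreal (\<delta> * e)"
    using sets_lebesgue_outer_open[OF E, of "\<delta> * e"] \<delta> e by auto
  define I where "I = {(x,\<rho>). 0 < \<rho> \<and> ball x \<rho> \<subseteq> T \<and>
      measure lebesgue (ball x \<rho>) * e \<le> measure lebesgue (ball x \<rho> - E)}"
  have "\<exists>i. i \<in> I \<and> x \<in> ball (fst i) (snd i) \<and> snd i < d" if "x \<in> N" "0 < d" for x d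
  proof -
    obtain d' where d': "d' > 0" "ball x d' \<subseteq> T"
      using T \<open>x \<in> N\<close> \<open>N \<subseteq> E\<close> open_contains_ball by blast
    obtain \<rho> where "0 < \<rho>" "\<rho> < min d d'" "measure lebesgue (ball x \<rho>) * e \<le> measure lebesgue (ball x \<rho> - E)"
      using deficit[OF \<open>x \<in> N\<close>, of "min d d'"] \<open>d > 0\<close> \<open>d' > 0\<close> by auto
    then have "(x, \<rho>) \<in> I"
      using d' by (auto simp: I_def)
    then show ?thesis
      using \<open>0 < \<rho>\<close> \<open>\<rho> < min d d'\<close> by (intro exI[of _ "(x,\<rho>)"]) auto
  qed
  then obtain C where C: "countable C" "C \<subseteq> I"
     "pairwise (\<lambda>i j. disjnt (ball (fst i) (snd i)) (ball (fst j) (snd j))) C"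
     "negligible (N - (\<Union>i \<in> C. ball (fst i) (snd i)))"
    using Vitali_covering_theorem_balls[of N I fst snd] by blast
  define W where "W = (\<Union>i \<in> C. ball (fst i) (snd i))"
  have "emeasure lebesgue W \<le> ennreal (1 / e) * emeasure lebesgue (T - E)"
    unfolding W_def
  proof (rule emeasure_UN_le_disjoint[where G = "\<lambda>i. ball (fst i) (snd i) - E"])
    show "disjoint_family_on (\<lambda>i. ball (fst i) (snd i) - E) C"
      using C(3) by (fastforce simp: disjoint_family_on_def pairwise_def disjnt_iff)
    fix i assume "i \<in> C"
    then have "(fst i, snd i) \<in> I"
      using C by auto
    then have i: "measure lebesgue (ball (fst i) (snd i)) * e \<le> measure lebesgue (ball (fst i) (snd i) - E)"
      and "ball (fst i) (snd i) \<subseteq> T"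
      unfolding I_def by blast+
    then show "ball (fst i) (snd i) - E \<subseteq> T - E"
      by auto
    have "ball (fst i) (snd i) - E \<in> lmeasurable"
      using E by (meson fmeasurable_Diff lmeasurable_ball)
    then show "emeasure lebesgue (ball (fst i) (snd i)) \<le> ennreal (1/e) * emeasure lebesgue (ball (fst i) (snd i) - E)"
      using i e by (simp add: emeasure_eq_measure2 lmeasurable_ball ennreal_mult[symmetric] field_simps)
  qed (use C E T in auto)
  also have "\<dots> \<le> ennreal (1/e) * ennreal (\<delta> * e)"
    using T by (intro mult_left_mono) auto
  also have "\<dots> = ennreal \<delta>"
    using e \<delta> by (simp add: ennreal_mult[symmetric])
  finally have W: "emeasure lebesgue W \<le> ennreal \<delta>" .
  have "W \<in> sets lebesgue"
    using C(1) by (auto simp: W_def)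
  then have Wm: "W \<in> lmeasurable"
    using W by (auto simp: fmeasurable_def intro: le_less_trans)
  let ?Z = "N - W"
  have Z: "negligible ?Z" using C(4) by (simp add: W_def)
  have "measure lebesgue (W \<union> ?Z) = measure lebesgue W"
    using Z Wm by (intro measure_Un_null_set) (auto simp: negligible_iff_null_sets)
  also have "\<dots> \<le> \<delta>"
    using W \<delta> Wm by (simp add: emeasure_eq_measure2)
  finally show "\<exists>T. N \<subseteq> T \<and> T \<in> lmeasurable \<and> measure lebesgue T \<le> \<delta>"
    using fmeasurable.Un[OF Wm negligible_imp_measurable[OF Z]] by (intro exI[of _ "W \<union> ?Z"]) auto
qed

text \<open>
  A point that is not of density one sees, for some \<open>m\<close>, a missing proportion of at least
  \<open>1 / Suc m\<close> at arbitrarily small radii, so the exceptional points form a countable union of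
  null sets.
\<close>

theorem Lebesgue_density:
  fixes E :: "'a::euclidean_space set"
  assumes E: "E \<in> sets lebesgue"
  shows "negligible (E - density_one_points E)"
proof -
  define N where "N m = {x \<in> E. \<forall>d>0. \<exists>\<rho>. 0 < \<rho> \<and> \<rho> < d \<and>
      measure lebesgue (ball x \<rho>) * (1 / real (Suc m)) \<le> measure lebesgue (ball x \<rho> - E)}" for m
  have "negligible (N m)" for m
    by (rule negligible_persistent_deficit[OF E, of _ "1 / real (Suc m)"]) (auto simp: N_def)
  then have "negligible (\<Union>m. N m)"
    by (intro negligible_countable_Union) auto
  moreover have "E - density_one_points E \<subseteq> (\<Union>m. N m)"
  proof
    fix x assume x: "x \<in> E - density_one_points E"
    then obtain e where e: "e > 0" and far: "\<And>b. b > 0 \<Longrightarrow> \<exists>\<rho>>0. \<rho> < b \<and>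
        e \<le> \<bar>measure lebesgue (E \<inter> ball x \<rho>) / measure lebesgue (ball x \<rho>) - 1\<bar>"
      by (force simp: density_one_points_def tendsto_iff eventually_at_right_field dist_real_def not_less)
    obtain m where m: "1 / real (Suc m) < e"
      using reals_Archimedean[OF e] by (auto simp: inverse_eq_divide)
    have "x \<in> N m"
      unfolding N_def
    proof (intro CollectI conjI allI impI)
      fix d :: real assume "d > 0"
      from far[OF this] obtain \<rho> where \<rho>: "\<rho> > 0" "\<rho> < d"
        "e \<le> \<bar>measure lebesgue (E \<inter> ball x \<rho>) / measure lebesgue (ball x \<rho>) - 1\<bar>"
        by blast
      let ?v = "measure lebesgue (ball x \<rho>)"
      have v: "?v > 0"
        using \<rho> by (simp add: content_ball_pos)
      have eq: "measure lebesgue (ball x \<rho> - E) = ?v - measure lebesgue (E \<inter> ball x \<rho>)"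
        using E by (intro measure_Diff_eq lmeasurable_ball)
      have "measure lebesgue (E \<inter> ball x \<rho>) \<le> ?v"
        using E by (intro measure_mono_fmeasurable) (auto simp: lmeasurable_ball)
      then have "measure lebesgue (E \<inter> ball x \<rho>) / ?v \<le> 1"
        using v by (simp only: divide_le_eq_1_pos)
      then have "e \<le> 1 - measure lebesgue (E \<inter> ball x \<rho>) / ?v"
        using \<rho>(3) by linarith
      then have "e * ?v \<le> (1 - measure lebesgue (E \<inter> ball x \<rho>) / ?v) * ?v"
        using v by (intro mult_right_mono) simp_all
      also have "\<dots> = ?v - measure lebesgue (E \<inter> ball x \<rho>)"
        using v by (simp only: left_diff_distrib) simp
      finally have "e * ?v \<le> ?v - measure lebesgue (E \<inter> ball x \<rho>)" .
      moreover have "1 / real (Suc m) * ?v \<le> e * ?v"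
        using m v by (intro mult_right_mono) simp_all
      ultimately have "?v * (1 / real (Suc m)) \<le> measure lebesgue (ball x \<rho> - E)"
        unfolding eq by (simp only: mult.commute)
      then show "\<exists>\<rho>. 0 < \<rho> \<and> \<rho> < d \<and>
          measure lebesgue (ball x \<rho>) * (1 / real (Suc m)) \<le> measure lebesgue (ball x \<rho> - E)"
        using \<rho> by blast
    qed (use x in auto)
    then show "x \<in> (\<Union>m. N m)" by blast
  qed
  ultimately show ?thesis
    by (rule negligible_subset)
qed

text \<open>
  The proportions of a ball occupied by a set and by its complement add up to one, so they cannot
  both tend to one. This lets the density theorem for the complement control the density points
  of \<open>E\<close> outside \<open>E\<close>.
\<close>

lemma density_one_points_Compl_disjoint:
  fixes E :: "'a::euclidean_space set"
  assumes E: "E \<in> sets lebesgue"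
  shows "density_one_points E \<inter> density_one_points (- E) = {}"
proof -
  have False if x: "x \<in> density_one_points E" "x \<in> density_one_points (- E)" for x
  proof -
    let ?f = "\<lambda>A \<rho>. measure lebesgue (A \<inter> ball x \<rho>) / measure lebesgue (ball x \<rho>)"
    have "((\<lambda>\<rho>. ?f E \<rho> + ?f (- E) \<rho>) \<longlongrightarrow> 1 + 1) (at_right 0)"
      using x unfolding density_one_points_def by (intro tendsto_add) auto
    moreover have "?f E \<rho> + ?f (- E) \<rho> = 1" if "\<rho> > 0" for \<rho>
    proof -
      have "measure lebesgue (ball x \<rho> - E) = measure lebesgue (ball x \<rho>) - measure lebesgue (E \<inter> ball x \<rho>)"
        using E by (intro measure_Diff_eq lmeasurable_ball)
      moreover have "- E \<inter> ball x \<rho> = ball x \<rho> - E"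
        by auto
      ultimately show ?thesis
        using that content_ball_pos[OF that, of x] by (simp add: add_divide_distrib[symmetric])
    qed
    then have "\<forall>\<^sub>F \<rho> in at_right 0. ?f E \<rho> + ?f (- E) \<rho> = 1"
      by (auto simp: eventually_at_right_field intro: exI[of _ 1])
    ultimately have "((\<lambda>_. 1::real) \<longlongrightarrow> 1 + 1) (at_right (0::real))"
      using tendsto_cong by fast
    then show False
      by (simp add: tendsto_const_iff)
  qed
  then show ?thesis by blast
qed

corollary negligible_density_one_points_minus:
  fixes E :: "'a::euclidean_space set"
  assumes E: "E \<in> sets lebesgue"
  shows "negligible (density_one_points E - E)"
proof (rule negligible_subset)
  show "negligible (- E - density_one_points (- E))"
    using E by (intro Lebesgue_density) (auto simp: Compl_in_sets_lebesgue)
  show "density_one_points E - E \<subseteq> - E - density_one_points (- E)"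
    using density_one_points_Compl_disjoint[OF E] by auto
qed

section \<open>Pairs of points separated by the boundary\<close>

lemma open_fattening: "open (fattening A r)"
  by (auto simp: fattening_def)

lemma fattening_mono: "r \<le> s \<Longrightarrow> fattening A r \<subseteq> fattening A s"
  by (auto simp: fattening_def)

lemma closed_cover_meets_segment:
  fixes p q :: "'a::real_normed_vector"
  assumes "closed P" "closed Q" "P \<union> Q = UNIV" "p \<in> P" "q \<in> Q"
  obtains s where "0 \<le> s" "s \<le> 1" "(1 - s) *\<^sub>R p + s *\<^sub>R q \<in> P \<inter> Q"
proof -
  have "P \<inter> Q \<inter> closed_segment p q \<noteq> {}"
  proof
    assume "P \<inter> Q \<inter> closed_segment p q = {}"
    moreover have "connected (closed_segment p q)"
      by simp
    ultimately have "P \<inter> closed_segment p q = {} \<or> Q \<inter> closed_segment p q = {}"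
      using assms unfolding connected_closed by blast
    then show False
      using assms by auto
  qed
  then show ?thesis
    using that by (auto simp: closed_segment_def)
qed

lemma open_affine_preimage:
  fixes G :: "'a::real_normed_vector set"
  shows "open G \<Longrightarrow> open {y. c + t *\<^sub>R y \<in> G}"
proof -
  assume "open G"
  moreover have "continuous_on UNIV (\<lambda>y. c + t *\<^sub>R y)"
    by (intro continuous_intros)
  ultimately show ?thesis
    using open_vimage[of G "\<lambda>y. c + t *\<^sub>R y"] by (simp add: vimage_def)
qed

lemma open_in_sets_lborel_pair:
  fixes S :: "('a::euclidean_space \<times> 'b::euclidean_space) set"
  assumes "open S"
  shows "S \<in> sets (lborel \<Otimes>\<^sub>M lborel)"
proof -
  have "sets (lborel \<Otimes>\<^sub>M lborel) = sets (borel \<Otimes>\<^sub>M borel :: ('a \<times> 'b) measure)"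
    by (intro sets_pair_measure_cong) simp_all
  moreover have "S \<in> sets (borel \<Otimes>\<^sub>M borel)"
    unfolding borel_prod using assms by (rule borel_open)
  ultimately show ?thesis
    by blast
qed

lemma open_pairs_with_intermediate_point:
  fixes D G :: "'a::real_normed_vector set"
  assumes D: "open D" and G: "open G"
  shows "open {(x,y). x \<in> D \<and> y \<in> D \<and> (1 - t) *\<^sub>R x + t *\<^sub>R y \<in> G}" (is "open ?S")
proof -
  have "?S = (D \<times> D) \<inter> (\<lambda>z. (1 - t) *\<^sub>R fst z + t *\<^sub>R snd z) -` G"
    by auto
  moreover have "open \<dots>"
    using D G by (intro open_Int open_Times open_vimage continuous_intros) auto
  ultimately show ?thesis
    by metis
qed

lemma emeasure_affine_preimage_le:
  fixes G :: "'a::euclidean_space set"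
  assumes "1/2 \<le> t" and G: "open G"
  shows "emeasure lborel {y. c + t *\<^sub>R y \<in> G} \<le> 2 ^ DIM('a) * emeasure lborel G"
proof -
  have "{y. c + t *\<^sub>R y \<in> G} = (\<lambda>x. (1/t) *\<^sub>R x + (- (1/t) *\<^sub>R c)) ` G" (is "?L = ?R")
  proof
    show "?R \<subseteq> ?L" using assms by (auto simp: algebra_simps)
    show "?L \<subseteq> ?R"
    proof
      fix y assume "y \<in> ?L"
      then show "y \<in> ?R"
        using assms by (intro image_eqI[of _ _ "c + t *\<^sub>R y"]) (auto simp: algebra_simps)
    qed
  qed
  then have "emeasure lebesgue ?L = ennreal (\<bar>1/t\<bar> ^ DIM('a)) * emeasure lebesgue G"
    by (simp only: emeasure_lebesgue_affine)
  also have "\<dots> \<le> ennreal (2 ^ DIM('a)) * emeasure lebesgue G"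
    using assms by (intro mult_right_mono ennreal_leI power_mono) (auto simp: field_simps)
  finally have "emeasure lebesgue ?L \<le> ennreal (2 ^ DIM('a)) * emeasure lebesgue G" .
  moreover have "open ?L"
    using G by (rule open_affine_preimage)
  ultimately show ?thesis
    using G by (simp add: ennreal_power[symmetric])
qed

text \<open>
  One of the weights \<open>t\<close> and \<open>1 - t\<close> is at least one half. With the other end point fixed, the
  intermediate point is then an affine function of the heavy one whose inverse expands volume
  by at most \<open>2 ^ n\<close>; integrating over the fixed end point gives the bound.
\<close>

lemma emeasure_pairs_with_intermediate_point_le:
  fixes D G :: "'a::euclidean_space set"
  assumes D: "open D" and G: "open G"
  shows "emeasure (lborel \<Otimes>\<^sub>M lborel) {(x,y). x \<in> D \<and> y \<in> D \<and> (1 - t) *\<^sub>R x + t *\<^sub>R y \<in> G}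
           \<le> 2 ^ DIM('a) * emeasure lborel G * emeasure lborel D" (is "emeasure _ ?S \<le> ?c * _")
proof -
  have S: "?S \<in> sets (lborel \<Otimes>\<^sub>M lborel)"
    using D G by (intro open_in_sets_lborel_pair open_pairs_with_intermediate_point)
  show ?thesis
  proof (cases "1/2 \<le> t")
    case True
    have "emeasure (lborel \<Otimes>\<^sub>M lborel) ?S = (\<integral>\<^sup>+x. emeasure lborel (Pair x -` ?S) \<partial>lborel)"
      using S by (rule lborel.emeasure_pair_measure_alt)
    also have "\<dots> \<le> (\<integral>\<^sup>+x. ?c * indicator D x \<partial>lborel)"
    proof (rule nn_integral_mono)
      fix x :: 'a
      have "emeasure lborel (Pair x -` ?S) \<le> emeasure lborel {y. (1 - t) *\<^sub>R x + t *\<^sub>R y \<in> G}" if "x \<in> D"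
        using G by (intro emeasure_mono) (auto intro!: borel_open open_affine_preimage)
      also have "\<dots> \<le> ?c"
        using True G by (rule emeasure_affine_preimage_le)
      finally show "emeasure lborel (Pair x -` ?S) \<le> ?c * indicator D x"
        by (cases "x \<in> D") (auto simp: indicator_def)
    qed
    also have "\<dots> = ?c * emeasure lborel D"
      using D by (simp add: nn_integral_cmult_indicator)
    finally show ?thesis .
  next
    case False
    have "emeasure (lborel \<Otimes>\<^sub>M lborel) ?S = (\<integral>\<^sup>+y. emeasure lborel ((\<lambda>x. (x,y)) -` ?S) \<partial>lborel)"
      using S by (rule lborel_pair.emeasure_pair_measure_alt2)
    also have "\<dots> \<le> (\<integral>\<^sup>+y. ?c * indicator D y \<partial>lborel)"
    proof (rule nn_integral_mono)
      fix y :: 'a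
      have "emeasure lborel ((\<lambda>x. (x,y)) -` ?S) \<le> emeasure lborel {x. t *\<^sub>R y + (1 - t) *\<^sub>R x \<in> G}" if "y \<in> D"
        using G by (intro emeasure_mono) (auto simp: add.commute intro!: borel_open open_affine_preimage)
      also have "\<dots> \<le> ?c"
        using False G by (intro emeasure_affine_preimage_le) auto
      finally show "emeasure lborel ((\<lambda>x. (x,y)) -` ?S) \<le> ?c * indicator D y"
        by (cases "y \<in> D") (auto simp: indicator_def)
    qed
    also have "\<dots> = ?c * emeasure lborel D"
      using D by (simp add: nn_integral_cmult_indicator)
    finally show ?thesis .
  qed
qed

text \<open>
  The quantitative form of the fact that a path from \<open>P\<close> to \<open>Q\<close> must pass through \<open>P \<inter> Q\<close>. The unit
  parameter interval is divided by a grid so fine that, on a segment of length less than \<open>2 * \<rho>\<close>,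
  consecutive grid points are at most \<open>r\<close> apart. A segment joining the two sets therefore has a grid
  point inside the fattened intersection, so the product of the two sets is covered by about \<open>\<rho> / r\<close>
  sets of pairs whose intermediate point, at a fixed ratio, lies in the fattening. The grid replaces
  an integral over the position on the segment.
\<close>

proposition relative_isoperimetric_product:
  fixes D P Q :: "'a::euclidean_space set"
  assumes PQ: "closed P" "closed Q" "P \<union> Q = UNIV"
    and D: "open D" "convex D" "D \<subseteq> ball z \<rho>" and r: "0 < r" "r \<le> \<rho>"
  shows "emeasure lborel (P \<inter> D) * emeasure lborel (Q \<inter> D)
      \<le> ennreal (4 * \<rho> / r) * (2 ^ DIM('a) * emeasure lborel (fattening (P \<inter> Q) r \<inter> D) * emeasure lborel D)"
    (is "_ \<le> _ * ?c")
proof -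
  define N where "N = nat \<lceil>2 * \<rho> / r\<rceil>"
  have N: "2 * \<rho> / r \<le> real N" "real N + 1 \<le> 4 * \<rho> / r" "N > 0"
  proof -
    have *: "1 \<le> \<rho> / r" using r by simp
    then have "real N = \<lceil>2 * \<rho> / r\<rceil>" unfolding N_def by simp
    then show "2 * \<rho> / r \<le> real N" "real N + 1 \<le> 4 * \<rho> / r" "N > 0"
      using * by linarith+
  qed
  let ?G = "fattening (P \<inter> Q) r \<inter> D"
  define S where "S j = {(x,y). x \<in> D \<and> y \<in> D \<and> (1 - real j / real N) *\<^sub>R x + (real j / real N) *\<^sub>R y \<in> ?G}" for j
  have G: "open ?G" using D by (simp add: open_fattening open_Int)
  have S: "S j \<in> sets (lborel \<Otimes>\<^sub>M lborel)" for j
    using D G unfolding S_def by (intro open_in_sets_lborel_pair open_pairs_with_intermediate_point)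
  have cover: "(P \<inter> D) \<times> (Q \<inter> D) \<subseteq> (\<Union>j\<in>{..N}. S j)"
  proof clarify
    fix p q assume p: "p \<in> P" "p \<in> D" and q: "q \<in> Q" "q \<in> D"
    obtain s where s: "0 \<le> s" "s \<le> 1" "(1 - s) *\<^sub>R p + s *\<^sub>R q \<in> P \<inter> Q"
      using closed_cover_meets_segment[OF PQ] p q by blast
    define j where "j = nat \<lfloor>s * real N\<rfloor>"
    have j: "real j \<le> s * real N" "s * real N < real j + 1"
      using s by (auto simp: j_def)
    then have "real j \<le> real N"
      using s mult_left_le_one_le[of "real N" s] by linarith
    define t where "t = real j / real N"
    have t: "0 \<le> t" "t \<le> 1"
      using N(3) \<open>real j \<le> real N\<close> by (auto simp: t_def)
    have "t - s \<le> 1 / real N" "s - t \<le> 1 / real N"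
    proof -
      have "(s - t) * real N = s * real N - real j"
        using N(3) by (simp add: t_def left_diff_distrib)
      then have "(s - t) * real N \<le> 1" "(t - s) * real N \<le> 1"
        using j by (auto simp: left_diff_distrib)
      then show "t - s \<le> 1 / real N" "s - t \<le> 1 / real N"
        using N(3) by (simp_all add: pos_le_divide_eq)
    qed
    then have ts: "\<bar>t - s\<bar> \<le> 1 / real N"
      by simp
    let ?y = "(1 - t) *\<^sub>R p + t *\<^sub>R q" and ?w = "(1 - s) *\<^sub>R p + s *\<^sub>R q"
    have "dist p z < \<rho>" "dist q z < \<rho>"
      using p q D by (auto simp: dist_commute)
    then have pq: "norm (q - p) < 2 * \<rho>"
      using dist_triangle2[of q p z] by (simp add: dist_norm)
    have "dist ?w ?y = \<bar>t - s\<bar> * norm (q - p)"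
    proof -
      have "?y - ?w = (t - s) *\<^sub>R (q - p)" by (simp add: algebra_simps)
      then show ?thesis by (metis dist_commute dist_norm norm_scaleR)
    qed
    also have "\<dots> \<le> 1 / real N * norm (q - p)"
      using ts by (intro mult_right_mono) auto
    also have "\<dots> < 1 / real N * (2 * \<rho>)"
      using pq N by (intro mult_strict_left_mono) auto
    also have "\<dots> \<le> r"
      using N r by (simp add: field_simps)
    finally have "?y \<in> fattening (P \<inter> Q) r"
      using s by (auto simp: fattening_def)
    moreover have "?y \<in> D"
      using D(2) p q t by (auto simp: convex_alt)
    ultimately have "(p,q) \<in> S j"
      using p q by (simp add: S_def t_def)
    then show "(p,q) \<in> (\<Union>j\<in>{..N}. S j)"
      using \<open>real j \<le> real N\<close> by auto
  qed
  have "emeasure lborel (P \<inter> D) * emeasure lborel (Q \<inter> D) = emeasure (lborel \<Otimes>\<^sub>M lborel) ((P \<inter> D) \<times> (Q \<inter> D))"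
    using PQ D by (intro lborel.emeasure_pair_measure_Times[symmetric]) auto
  also have "\<dots> \<le> emeasure (lborel \<Otimes>\<^sub>M lborel) (\<Union>j\<in>{..N}. S j)"
    using cover S by (intro emeasure_mono) auto
  also have "\<dots> \<le> (\<Sum>j\<in>{..N}. emeasure (lborel \<Otimes>\<^sub>M lborel) (S j))"
    using S by (intro emeasure_subadditive_finite) auto
  also have "\<dots> \<le> (\<Sum>j\<in>{..N}. ?c)"
    unfolding S_def by (intro sum_mono emeasure_pairs_with_intermediate_point_le D G)
  also have "\<dots> = ennreal (real N + 1) * ?c"
    by (simp add: ennreal_of_nat_eq_real_of_nat add.commute)
  also have "\<dots> \<le> ennreal (4 * \<rho> / r) * ?c"
    using N by (intro mult_right_mono ennreal_leI) auto
  finally show ?thesis .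
qed

corollary relative_isoperimetric_product_real:
  fixes D P Q :: "'a::euclidean_space set"
  assumes PQ: "closed P" "closed Q" "P \<union> Q = UNIV"
    and D: "open D" "convex D" "D \<subseteq> ball z \<rho>" and r: "0 < r" "r \<le> \<rho>"
  shows "measure lebesgue (P \<inter> D) * measure lebesgue (Q \<inter> D)
      \<le> 4 * \<rho> / r * (2 ^ DIM('a) * measure lebesgue (fattening (P \<inter> Q) r \<inter> D) * measure lebesgue D)"
proof -
  have fin: "emeasure lborel X = ennreal (measure lebesgue X)" if "X \<in> sets borel" "X \<subseteq> D" for X
  proof -
    have "X \<in> lmeasurable"
      using that D(3) by (intro bounded_set_imp_lmeasurable) (auto intro: bounded_subset[OF bounded_ball])
    then show ?thesis
      using that emeasure_eq_measure2[of X lebesgue] by simp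
  qed
  show ?thesis
    using relative_isoperimetric_product[OF assms] PQ D r
    by (simp add: fin open_fattening ennreal_mult[symmetric] ennreal_power flip: ennreal_numeral)
qed

section \<open>The fattened boundary near a density point\<close>

text \<open>
  A ball centred inside another ball of comparable size keeps a fixed proportion of its volume there:
  pulling the centre towards the origin by \<open>\<rho> / 4\<close> at most makes room for a ball of that radius.
\<close>

lemma ball_quarter_in_Int_ball:
  fixes x :: "'a::real_normed_vector"
  assumes x: "x \<in> ball 0 R" and \<rho>: "0 < \<rho>" "\<rho> \<le> 2 * R"
  obtains y where "ball y (\<rho>/4) \<subseteq> ball 0 R \<inter> ball x \<rho>"
proof
  define s where "s = \<rho> / (4 * R)"
  have s: "0 \<le> s" "s \<le> 1" "s * R = \<rho> / 4"
    using \<rho> by (auto simp: s_def field_simps)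
  let ?y = "(1 - s) *\<^sub>R x"
  have "norm x < R" using x by simp
  then have "s * norm x \<le> \<rho>/4" "(1 - s) * norm x \<le> R - \<rho>/4"
    using s mult_left_mono[of "norm x" R s] mult_left_mono[of "norm x" R "1 - s"] by (auto simp: algebra_simps)
  moreover have "norm ?y = (1 - s) * norm x" "dist x ?y = s * norm x"
    using s(1,2) by (simp_all add: dist_norm flip: scaleR_left_diff_distrib) (simp add: scaleR_left_diff_distrib)
  ultimately have "norm ?y \<le> R - \<rho>/4" "dist x ?y \<le> \<rho>/4"
    by metis+
  then have "norm z < R" "dist x z < \<rho>" if "dist ?y z < \<rho>/4" for z
    using that \<rho>(1) norm_triangle_sub[of z ?y] dist_triangle[of x z ?y]
    by (auto simp: dist_norm norm_minus_commute simp del: norm_scaleR)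
  then show "ball ?y (\<rho>/4) \<subseteq> ball 0 R \<inter> ball x \<rho>"
    by auto
qed

corollary measure_ball_Int_ball_ge:
  fixes x :: "'a::euclidean_space"
  assumes "x \<in> ball 0 R" "0 < \<rho>" "\<rho> \<le> 2 * R"
  shows "unit_ball_vol (real DIM('a)) * (\<rho>/4) ^ DIM('a) \<le> measure lebesgue (ball 0 R \<inter> ball x \<rho>)"
proof -
  obtain y where "ball y (\<rho>/4) \<subseteq> ball 0 R \<inter> ball x \<rho>"
    using ball_quarter_in_Int_ball assms by blast
  then have "measure lebesgue (ball y (\<rho>/4)) \<le> measure lebesgue (ball 0 R \<inter> ball x \<rho>)"
    by (intro measure_mono_fmeasurable) (auto simp: lmeasurable_ball fmeasurable_Int_fmeasurable)
  then show ?thesis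
    using assms by (simp add: content_ball)
qed

text \<open>
  Among the radii \<open>2 * R / 2 ^ j\<close>, at \<open>j = 0\<close> the set \<open>E\<close> fills at most half of the region, and for large
  \<open>j\<close> more than half, since \<open>x\<close> is a density point. Just before the first \<open>j\<close> of the latter kind
  the complement still has at least half, and \<open>E\<close> has already half of the region of half the radius.
  Passing through dyadic radii avoids any continuity in the radius.
\<close>

lemma balanced_ball:
  fixes E :: "'a::euclidean_space set"
  assumes E: "E \<in> sets lebesgue" and x: "x \<in> ball 0 R" "x \<in> density_one_points E"
    and half: "measure lebesgue (E \<inter> ball 0 R) \<le> measure lebesgue (ball (0::'a) R) / 2"
  obtains \<rho> where "0 < \<rho>" "\<rho> \<le> 2 * R"
    "measure lebesgue (E \<inter> (ball 0 R \<inter> ball x \<rho>)) \<le> measure lebesgue (ball 0 R \<inter> ball x \<rho>) / 2"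
    "measure lebesgue (ball 0 R \<inter> ball x (\<rho>/2)) / 2 < measure lebesgue (E \<inter> (ball 0 R \<inter> ball x \<rho>))"
proof -
  define big where "big \<rho> \<longleftrightarrow> measure lebesgue (ball 0 R \<inter> ball x \<rho>) / 2 < measure lebesgue (E \<inter> (ball 0 R \<inter> ball x \<rho>))" for \<rho>
  have R: "R > 0" using x(1) by (auto intro: le_less_trans[OF norm_ge_zero])
  have "ball 0 R \<subseteq> ball x (2 * R)"
  proof
    fix y :: 'a assume "y \<in> ball 0 R"
    then show "y \<in> ball x (2 * R)"
      using x(1) norm_triangle_ineq4[of x y] by (simp add: dist_norm)
  qed
  then have "ball 0 R \<inter> ball x (2 * R) = ball 0 R" by auto
  then have not_big: "\<not> big (2 * R)"
    using half by (simp add: big_def)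
  have "\<forall>\<^sub>F \<rho> in at_right 0. 1/2 < measure lebesgue (E \<inter> ball x \<rho>) / measure lebesgue (ball x \<rho>)"
    using x(2) unfolding density_one_points_def by (intro order_tendstoD(1)[of _ 1]) auto
  then obtain d where d: "d > 0" "\<And>\<rho>. 0 < \<rho> \<Longrightarrow> \<rho> < d \<Longrightarrow> 1/2 < measure lebesgue (E \<inter> ball x \<rho>) / measure lebesgue (ball x \<rho>)"
    by (auto simp: eventually_at_right_field)
  obtain d' where d': "d' > 0" "ball x d' \<subseteq> ball 0 R"
    using openE[OF open_ball x(1)] by blast
  obtain k where "(1/2) ^ k < min d d' / (2 * R)"
    using real_arch_pow_inv[of "min d d' / (2 * R)" "1/2"] d(1) d'(1) R by auto
  then have k: "2 * R / 2 ^ k < min d d'"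
    using R by (simp add: power_one_over pos_less_divide_eq mult_ac del: min_less_iff_conj)
  have "big (2 * R / 2 ^ k)"
  proof -
    let ?\<rho> = "2 * R / 2 ^ k"
    have \<rho>: "?\<rho> > 0" "?\<rho> < d" "?\<rho> < d'" using R k by auto
    then have "ball x ?\<rho> \<subseteq> ball 0 R"
      using d'(2) subset_ball[of ?\<rho> d' x] by auto
    then have "ball 0 R \<inter> ball x ?\<rho> = ball x ?\<rho>" by auto
    then show ?thesis
      using d(2)[OF \<rho>(1,2)] content_ball_pos[OF \<rho>(1), of x] by (simp add: big_def field_simps)
  qed
  define j where "j = (LEAST j. big (2 * R / 2 ^ j))"
  have j: "big (2 * R / 2 ^ j)"
    unfolding j_def by (rule LeastI) fact
  then have "j \<noteq> 0" using not_big by (metis div_by_1 power_0)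
  then obtain i where i: "j = Suc i" by (metis not0_implies_Suc)
  have ni: "\<not> big (2 * R / 2 ^ i)"
    using not_less_Least[of i "\<lambda>j. big (2 * R / 2 ^ j)"] i j_def by simp
  show ?thesis
  proof
    let ?\<rho> = "2 * R / 2 ^ i"
    show "0 < ?\<rho>" using R by simp
    show "?\<rho> \<le> 2 * R" using R by (simp add: field_simps)
    show "measure lebesgue (E \<inter> (ball 0 R \<inter> ball x ?\<rho>)) \<le> measure lebesgue (ball 0 R \<inter> ball x ?\<rho>) / 2"
      using ni by (simp add: big_def)
    have "?\<rho>/2 = 2 * R / 2 ^ j" by (simp add: i)
    then have "measure lebesgue (ball 0 R \<inter> ball x (?\<rho>/2)) / 2 < measure lebesgue (E \<inter> (ball 0 R \<inter> ball x (?\<rho>/2)))"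
      using j unfolding big_def by metis
    also have "\<dots> \<le> measure lebesgue (E \<inter> (ball 0 R \<inter> ball x ?\<rho>))"
    proof (intro measure_mono_fmeasurable)
      show "E \<inter> (ball 0 R \<inter> ball x (?\<rho>/2)) \<subseteq> E \<inter> (ball 0 R \<inter> ball x ?\<rho>)"
        using subset_ball[of "?\<rho>/2" ?\<rho> x] \<open>0 < ?\<rho>\<close> by fastforce
      show "E \<inter> (ball 0 R \<inter> ball x (?\<rho>/2)) \<in> sets lebesgue"
        using E by auto
      have "ball 0 R \<inter> ball x ?\<rho> \<in> lmeasurable"
        by (intro bounded_set_imp_lmeasurable) auto
      then show "E \<inter> (ball 0 R \<inter> ball x ?\<rho>) \<in> lmeasurable"
        using E by (metis Int_commute fmeasurable_Int_fmeasurable)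
    qed
    finally show "measure lebesgue (ball 0 R \<inter> ball x (?\<rho>/2)) / 2 < measure lebesgue (E \<inter> (ball 0 R \<inter> ball x ?\<rho>))" .
  qed
qed

text \<open>
  The common factor \<open>w * \<rho> ^ (n + 1)\<close> cancels; the powers of \<open>2\<close> are collected by writing all of them
  as powers of \<open>2 ^ n\<close>.
\<close>

lemma fattened_boundary_arith:
  fixes w \<rho> r f :: real
  assumes pos: "w > 0" "\<rho> > 0" "r > 0" "n > 0"
    and le: "(w * (\<rho>/8) ^ n / 2) * (w * (\<rho>/4) ^ n / 2) \<le> 4 * \<rho> / r * (2 ^ n * f * (w * \<rho> ^ n))"
  shows "w / (16 * 64 ^ n) * r * \<rho> ^ (n - 1) \<le> f"
proof -
  define a q :: real where "a = 2 ^ n" and "q = \<rho> ^ (n - 1)"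
  have a: "a > 0" and q: "q > 0"
    using pos by (auto simp: a_def q_def)
  have powers: "8 ^ n = a ^ 3" "4 ^ n = a ^ 2" "64 ^ n = a ^ 6"
    by (simp_all add: a_def power_commutes flip: power_mult power_mult_distrib)
      (simp_all add: power_mult mult.commute[of n])
  have \<rho>n: "\<rho> ^ n = \<rho> * q"
    using pos by (simp add: q_def power_eq_if)
  have "(w * \<rho> * q * \<rho>) * (w * q / (4 * a ^ 5)) \<le> (w * \<rho> * q * \<rho>) * (4 * a * f / r)"
    using le a pos unfolding power_divide powers \<rho>n a_def[symmetric]
    by (simp add: field_simps power_numeral_reduce)
  then have "w * q / (4 * a ^ 5) \<le> 4 * a * f / r"
    by (rule mult_left_le_imp_le) (use pos q in simp)
  then have "w * q * r \<le> f * (16 * a ^ 6)"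
    using a pos by (simp add: field_simps power_numeral_reduce)
  then show ?thesis
    using a by (simp add: powers q_def field_simps)
qed

lemma measure_le_if_negligible_minus:
  assumes "X \<in> lmeasurable" "Y \<in> lmeasurable" "negligible (X - Y)"
  shows "measure lebesgue X \<le> measure lebesgue Y"
proof -
  have "measure lebesgue X \<le> measure lebesgue (Y \<union> (X - Y))"
    using assms by (intro measure_mono_fmeasurable fmeasurable.Un fmeasurable_Diff) auto
  also have "\<dots> = measure lebesgue Y"
    using assms by (intro measure_Un_null_set) (auto simp: negligible_iff_null_sets)
  finally show ?thesis .
qed

text \<open>
  At the balanced scale \<open>\<rho>\<close> both sides of the boundary have volume comparable to \<open>\<rho> ^ n\<close>. If \<open>r \<le> \<rho>\<close>,
  the estimate on pairs applies. If \<open>\<rho> < r\<close>, it is enough that there is a boundary point \<open>z\<close> within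
  distance \<open>r\<close> of \<open>x\<close>: the fattening contains all of \<open>ball z r\<close>, and the radius \<open>2 * r\<close> does it.
\<close>

lemma fattened_boundary_in_ball_ge:
  fixes E P Q :: "'a::euclidean_space set"
  assumes E: "E \<in> sets lebesgue" and x: "x \<in> ball 0 R" "x \<in> density_one_points E"
    and half: "measure lebesgue (E \<inter> ball 0 R) \<le> measure lebesgue (ball (0::'a) R) / 2"
    and r: "0 < r" "r \<le> R"
    and PQ: "closed P" "closed Q" "P \<union> Q = UNIV" "negligible (E - P)" "negligible (- E - Q)"
  obtains \<rho> where "0 < \<rho>" "\<rho> \<le> 2 * R"
    "unit_ball_vol (real DIM('a)) / (16 * 64 ^ DIM('a)) * r * \<rho> ^ (DIM('a) - 1)
       \<le> measure lebesgue (fattening (P \<inter> Q) r \<inter> ball 0 R \<inter> ball x \<rho>)"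
proof -
  let ?n = "DIM('a)" and ?w = "unit_ball_vol (real DIM('a))" and ?F = "fattening (P \<inter> Q) r"
  have w: "?w > 0" by simp
  obtain \<rho> where \<rho>: "0 < \<rho>" "\<rho> \<le> 2 * R"
    and le: "measure lebesgue (E \<inter> (ball 0 R \<inter> ball x \<rho>)) \<le> measure lebesgue (ball 0 R \<inter> ball x \<rho>) / 2"
    and ge: "measure lebesgue (ball 0 R \<inter> ball x (\<rho>/2)) / 2 < measure lebesgue (E \<inter> (ball 0 R \<inter> ball x \<rho>))"
    using balanced_ball[OF E x half] by blast
  define D where "D = ball 0 R \<inter> ball x \<rho>"
  have D: "open D" "convex D" "D \<subseteq> ball x \<rho>" "D \<in> lmeasurable"
    by (auto simp: D_def convex_Int lmeasurable_ball fmeasurable_Int_fmeasurable)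
  have sub: "A \<inter> D \<in> lmeasurable" "D \<inter> A \<in> lmeasurable" if "A \<in> sets lebesgue" for A
    using D(4) that by (auto simp: fmeasurable_Int_fmeasurable Int_commute[of A])
  have a: "?w * (\<rho>/8) ^ ?n / 2 \<le> measure lebesgue (P \<inter> D)"
  proof -
    have "?w * (\<rho>/8) ^ ?n \<le> measure lebesgue (ball 0 R \<inter> ball x (\<rho>/2))"
      using measure_ball_Int_ball_ge[OF x(1), of "\<rho>/2"] \<rho> by simp
    also have "\<dots> \<le> 2 * measure lebesgue (E \<inter> D)"
      using ge by (simp add: D_def)
    also have "measure lebesgue (E \<inter> D) \<le> measure lebesgue (P \<inter> D)"
      using E PQ sub by (intro measure_le_if_negligible_minus negligible_subset[OF PQ(4)]) auto
    finally show ?thesis by simp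
  qed
  have b: "?w * (\<rho>/4) ^ ?n / 2 \<le> measure lebesgue (Q \<inter> D)"
  proof -
    have "?w * (\<rho>/4) ^ ?n \<le> measure lebesgue D"
      using measure_ball_Int_ball_ge[OF x(1) \<rho>] by (simp add: D_def)
    also have "\<dots> \<le> 2 * measure lebesgue (D - E)"
      using le measure_Diff_eq[OF D(4) E] by (simp add: D_def)
    also have "measure lebesgue (D - E) \<le> measure lebesgue (Q \<inter> D)"
      using E PQ D sub
      by (intro measure_le_if_negligible_minus negligible_subset[OF PQ(5)] fmeasurable_Diff) auto
    finally show ?thesis by simp
  qed
  show ?thesis
  proof (cases "r \<le> \<rho>")
    case True
    let ?f = "measure lebesgue (?F \<inter> D)"
    have "measure lebesgue D \<le> measure lebesgue (ball x \<rho>)"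
      using D by (intro measure_mono_fmeasurable) (auto simp: lmeasurable_ball)
    then have d: "measure lebesgue D \<le> ?w * \<rho> ^ ?n"
      using \<rho> by (simp add: content_ball)
    have "(?w * (\<rho>/8) ^ ?n / 2) * (?w * (\<rho>/4) ^ ?n / 2) \<le> measure lebesgue (P \<inter> D) * measure lebesgue (Q \<inter> D)"
      using a b \<rho> w by (intro mult_mono) (simp_all add: less_imp_le)
    also have "\<dots> \<le> 4 * \<rho> / r * (2 ^ ?n * ?f * measure lebesgue D)"
      using PQ D r True by (intro relative_isoperimetric_product_real[where z = x]) auto
    also have "\<dots> \<le> 4 * \<rho> / r * (2 ^ ?n * ?f * (?w * \<rho> ^ ?n))"
      using d \<rho> r by (intro mult_left_mono) auto
    finally have "?w / (16 * 64 ^ ?n) * r * \<rho> ^ (?n - 1) \<le> ?f"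
      using w \<rho> r by (intro fattened_boundary_arith) auto
    then show ?thesis
      using that \<rho> by (simp add: D_def Int_assoc)
  next
    case False
    have "0 < ?w * (\<rho>/8) ^ ?n / 2" "0 < ?w * (\<rho>/4) ^ ?n / 2"
      using \<rho> w by auto
    then have "P \<inter> D \<noteq> {}" "Q \<inter> D \<noteq> {}"
      using a b by auto
    then obtain p q where pq: "p \<in> P" "p \<in> D" "q \<in> Q" "q \<in> D" by blast
    obtain s where s: "0 \<le> s" "s \<le> 1" "(1 - s) *\<^sub>R p + s *\<^sub>R q \<in> P \<inter> Q"
      using closed_cover_meets_segment[OF PQ(1-3)] pq by blast
    define z where "z = (1 - s) *\<^sub>R p + s *\<^sub>R q"
    have "z \<in> D"
      using D(2) pq s by (auto simp: convex_alt z_def)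
    then have z: "z \<in> ball 0 R" "dist x z < r" "z \<in> P \<inter> Q"
      using s False by (auto simp: D_def z_def)
    \<comment> \<open>The boundary point \<open>z\<close> lies in \<open>ball 0 R\<close>, so \<open>ball z r\<close> keeps a fixed proportion of its volume there.\<close>
    have "ball z r \<subseteq> ball x (2 * r)"
    proof
      fix y assume "y \<in> ball z r"
      then show "y \<in> ball x (2 * r)"
        using z(2) dist_triangle[of x y z] by simp
    qed
    moreover have "ball z r \<subseteq> ?F"
      using z(3) by (auto simp: fattening_def)
    ultimately have "ball 0 R \<inter> ball z r \<subseteq> ?F \<inter> ball 0 R \<inter> ball x (2 * r)"
      by auto
    moreover have "?F \<inter> ball 0 R \<inter> ball x (2 * r) \<in> lmeasurable"
      by (intro bounded_set_imp_lmeasurable) (auto simp: open_fattening)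
    ultimately have "measure lebesgue (ball 0 R \<inter> ball z r) \<le> measure lebesgue (?F \<inter> ball 0 R \<inter> ball x (2 * r))"
      by (intro measure_mono_fmeasurable) auto
    moreover have "?w * (r/4) ^ ?n \<le> measure lebesgue (ball 0 R \<inter> ball z r)"
      using z r by (intro measure_ball_Int_ball_ge) auto
    moreover have "?w / (16 * 64 ^ ?n) * r * (2 * r) ^ (?n - 1) \<le> ?w * (r/4) ^ ?n"
    proof -
      have "r * (2 * r) ^ (?n - 1) \<le> 2 ^ ?n * r ^ ?n"
        using r DIM_positive[where 'a = 'a] by (simp add: power_mult_distrib power_eq_if[of _ "DIM('a)"])
      then have "r * (2 * r) ^ (?n - 1) * 4 ^ ?n \<le> r ^ ?n * (2 ^ ?n * 4 ^ ?n)"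
        by (simp add: mult_ac)
      also have "(2::real) ^ ?n * 4 ^ ?n \<le> 64 ^ ?n"
        unfolding power_mult_distrib[symmetric] by (intro power_mono) auto
      also have "(64::real) ^ ?n \<le> 16 * 64 ^ ?n"
        by simp
      finally have "r * (2 * r) ^ (?n - 1) * 4 ^ ?n \<le> r ^ ?n * (16 * 64 ^ ?n)"
        using r by simp
      then show ?thesis
        using w by (simp add: power_divide field_simps)
    qed
    ultimately show ?thesis
      using that[of "2 * r"] r by simp
  qed
qed

section \<open>The relative isoperimetric inequality\<close>

text \<open>
  Vitali's covering lemma is applied to the balls about the density points of \<open>E\<close>, with constant
  proportional to \<open>S / r\<close>. In dimension one the exponent is zero, and the claim says that the fattened
  boundary has measure at least a multiple of \<open>r\<close> when \<open>E \<inter> ball 0 R\<close> is not null; the argument is the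
  same because \<open>S ^ (n - 1)\<close> is then one.
\<close>

proposition relative_isoperimetric_ball:
  fixes E :: "'a::euclidean_space set"
  assumes E: "E \<in> sets lebesgue"
    and half: "measure lebesgue (E \<inter> ball 0 R) \<le> measure lebesgue (ball (0::'a) R) / 2"
    and r: "0 < r" "r \<le> R"
  shows "measure lebesgue (E \<inter> ball 0 R) powr ((real DIM('a) - 1) / real DIM('a))
    \<le> (16 * 64 ^ DIM('a) / unit_ball_vol (real DIM('a)) + 16 * 320 ^ DIM('a)) / r
        * measure lebesgue (fattening (density_boundary E) r \<inter> ball 0 R)"
proof (cases "measure lebesgue (E \<inter> ball 0 R) = 0")
  case True
  \<comment> \<open>This includes dimension one, where the left-hand side is \<open>0 powr 0 = 0\<close>.\<close>
  then show ?thesis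
    using r by simp
next
  case False
  let ?n = "DIM('a)" and ?w = "unit_ball_vol (real DIM('a))"
  define m where "m = measure lebesgue (E \<inter> ball 0 R)"
  define G where "G = fattening (density_boundary E) r \<inter> ball 0 R"
  define c where "c = ?w / (16 * 64 ^ ?n)"
  have w: "?w > 0" and n: "?n > 0" and c: "c > 0"
    by (auto simp: c_def)
  have m: "m > 0"
    using False by (simp add: m_def zero_less_measure_iff)
  define S where "S = m powr (1 / real ?n)"
  have S: "S > 0"
    using m by (simp add: S_def)
  have SG: "m powr ((real ?n - 1) / real ?n) = S ^ (?n - 1)"
    using m n by (simp add: S_def powr_powr of_nat_diff Suc_leI flip: powr_realpow)
  have pow: "y ^ ?n = y * y ^ (?n - 1)" for y :: real
    using n by (simp add: power_eq_if)
  have "S ^ ?n = m"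
    using m n by (simp add: S_def powr_powr flip: powr_realpow)
  then have Sm: "m = S * S ^ (?n - 1)"
    by (simp only: pow)

  have G: "open G" "G \<in> lmeasurable"
    by (auto simp: G_def open_fattening intro!: bounded_set_imp_lmeasurable)
  have GI: "G \<inter> ball x \<rho> \<in> lmeasurable" for x \<rho>
    using G by (intro fmeasurable_Int_fmeasurable) auto
  define P Q where "P = closure (density_one_points E)" and "Q = closure (- density_one_points E)"
  have sub: "density_one_points E \<subseteq> P" "- density_one_points E \<subseteq> Q"
    by (simp_all only: P_def Q_def closure_subset)
  have PQ: "closed P" "closed Q" "P \<union> Q = UNIV"
    using sub by (auto simp: P_def Q_def)
  have bdry: "density_boundary E = P \<inter> Q"
    by (simp only: P_def Q_def density_boundary_def frontier_closures)
  have null: "negligible (E - P)" "negligible (- E - Q)"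
  proof -
    show "negligible (E - P)"
      using sub by (intro negligible_subset[OF Lebesgue_density[OF E]]) auto
    show "negligible (- E - Q)"
      using sub by (intro negligible_subset[OF negligible_density_one_points_minus[OF E]]) auto
  qed
  define X where "X = E \<inter> ball 0 R - (E - density_one_points E)"
  have X: "X \<in> sets lebesgue" "measure lebesgue X = m"
  proof -
    have "E - density_one_points E \<in> null_sets lebesgue"
      using Lebesgue_density[OF E] by (simp add: negligible_iff_null_sets)
    moreover have "E \<inter> ball 0 R \<in> sets lebesgue"
      using E by auto
    ultimately show "X \<in> sets lebesgue" "measure lebesgue X = m"
      unfolding X_def m_def using sets.Diff[OF _ null_setsD2] measure_Diff_null_set by blast+
  qed
  have Xm: "X \<in> lmeasurable"
    using X by (intro fmeasurableI2[OF lmeasurable_ball[of 0 R]]) (auto simp: X_def)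
  have "\<forall>x\<in>X. \<exists>\<rho>. 0 < \<rho> \<and> \<rho> \<le> 2 * R \<and> c * r * \<rho> ^ (?n - 1) \<le> measure lebesgue (G \<inter> ball x \<rho>)"
  proof
    fix x assume "x \<in> X"
    then have "x \<in> ball 0 R" "x \<in> density_one_points E"
      by (auto simp: X_def)
    from fattened_boundary_in_ball_ge[OF E this half r PQ(1-3) null]
    show "\<exists>\<rho>. 0 < \<rho> \<and> \<rho> \<le> 2 * R \<and> c * r * \<rho> ^ (?n - 1) \<le> measure lebesgue (G \<inter> ball x \<rho>)"
      unfolding G_def c_def bdry by metis
  qed
  then obtain \<rho> where \<rho>: "\<And>x. x \<in> X \<Longrightarrow> 0 < \<rho> x" "\<And>x. x \<in> X \<Longrightarrow> \<rho> x \<le> 2 * R"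
    "\<And>x. x \<in> X \<Longrightarrow> c * r * \<rho> x ^ (?n - 1) \<le> measure lebesgue (G \<inter> ball x (\<rho> x))"
    by metis
  let ?g = "measure lebesgue G"
  \<comment> \<open>A radius of at least \<open>S\<close> gives the estimate at once; otherwise \<open>\<rho> x\<close> may be bounded by \<open>S\<close> in
    one of the \<open>n\<close> factors of the volume of the enlarged ball.\<close>
  have "S ^ (?n - 1) \<le> ?g / (c * r) \<or> S ^ (?n - 1) \<le> 5 ^ ?n * ?w / (c * r) * ?g"
  proof (cases "\<exists>x\<in>X. S \<le> \<rho> x")
    case True
    then obtain x where x: "x \<in> X" "S \<le> \<rho> x" by blast
    have "c * r * S ^ (?n - 1) \<le> c * r * \<rho> x ^ (?n - 1)"
      using x S c r by (intro mult_left_mono power_mono) auto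
    also have "\<dots> \<le> measure lebesgue (G \<inter> ball x (\<rho> x))"
      using \<rho>(3) x by simp
    also have "\<dots> \<le> ?g"
      using G GI by (intro measure_mono_fmeasurable) auto
    finally show ?thesis
      using c r by (simp add: field_simps)
  next
    case False
    define k where "k = 5 ^ ?n * ?w * S / (c * r)"
    have k: "k > 0"
      using S c r w by (simp add: k_def)
    have "emeasure lebesgue X \<le> ennreal k * emeasure lebesgue G"
    proof (rule emeasure_le_Vitali[where b = "2 * R"])
      fix x assume x: "x \<in> X"
      have "measure lebesgue (ball x (5 * \<rho> x)) = 5 ^ ?n * ?w * (\<rho> x * \<rho> x ^ (?n - 1))"
        using \<rho>(1)[OF x] by (simp add: content_ball power_mult_distrib pow[of "\<rho> x"])
      also have "\<dots> \<le> 5 ^ ?n * ?w * (S * \<rho> x ^ (?n - 1))"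
        using False x \<rho>(1)[OF x] w by (intro mult_left_mono mult_right_mono) auto
      also have "\<dots> = k * (c * r * \<rho> x ^ (?n - 1))"
        using c r by (simp add: k_def)
      also have "\<dots> \<le> k * measure lebesgue (G \<inter> ball x (\<rho> x))"
        using k \<rho>(3)[OF x] by (intro mult_left_mono) auto
      finally show "emeasure lebesgue (ball x (5 * \<rho> x)) \<le> ennreal k * emeasure lebesgue (G \<inter> ball x (\<rho> x))"
        using k GI by (simp add: emeasure_eq_measure2 lmeasurable_ball ennreal_mult[symmetric])
    qed (use \<rho> X G in auto)
    then have "m \<le> k * ?g"
      using k G Xm X(2) by (simp add: emeasure_eq_measure2 ennreal_mult[symmetric])
    moreover have "k * ?g = S * (5 ^ ?n * ?w / (c * r) * ?g)"
      by (simp add: k_def)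
    ultimately have "S * S ^ (?n - 1) \<le> S * (5 ^ ?n * ?w / (c * r) * ?g)"
      by (simp only: Sm)
    then have "S ^ (?n - 1) \<le> 5 ^ ?n * ?w / (c * r) * ?g"
      using S by (rule mult_left_le_imp_le)
    then show ?thesis ..
  qed
  moreover have "?g / (c * r) = 16 * 64 ^ ?n / ?w / r * ?g"
    using w r by (simp add: c_def field_simps)
  moreover have "5 ^ ?n * ?w / (c * r) * ?g = 16 * 320 ^ ?n / r * ?g"
  proof -
    have "(320::real) ^ ?n = 5 ^ ?n * 64 ^ ?n"
      by (simp flip: power_mult_distrib)
    then show ?thesis
      using less_imp_neq[OF w] by (simp add: c_def)
  qed
  ultimately have "S ^ (?n - 1) \<le> 16 * 64 ^ ?n / ?w / r * ?g \<or> S ^ (?n - 1) \<le> 16 * 320 ^ ?n / r * ?g"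
    by metis
  moreover have "0 \<le> 16 * 64 ^ ?n / ?w / r * ?g" "0 \<le> 16 * 320 ^ ?n / r * ?g"
    using w r by auto
  ultimately have "S ^ (?n - 1) \<le> 16 * 64 ^ ?n / ?w / r * ?g + 16 * 320 ^ ?n / r * ?g"
    by linarith
  then show ?thesis
    by (simp only: SG add_divide_distrib distrib_right flip: m_def G_def)
qed

text \<open>
  It remains to remove the restriction \<open>r \<le> R\<close>. Replacing \<open>r\<close> by \<open>s = min r R\<close> shrinks the fattening, and
  \<open>r \<le> l * s\<close> shows that the normalising factor changes by \<open>l\<close> at most.
\<close>

theorem theorem1p13:
  "\<exists>C::real. C > 0 \<and>
     (\<forall>l R r :: real. l \<ge> 1 \<longrightarrow> R > 0 \<longrightarrow> r > 0 \<longrightarrow> l * R \<ge> r \<longrightarrow>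
       (\<forall>E :: (real ^ 'n) set. E \<in> sets lebesgue \<longrightarrow>
          measure lebesgue (E \<inter> ball 0 R) / measure lebesgue (ball (0 :: real ^ 'n) R) \<le> 1 / 2 \<longrightarrow>
          ennreal (measure lebesgue (E \<inter> ball 0 R) powr ((real CARD('n) - 1) / real CARD('n)))
            \<le> ennreal (C * l) * Per r E (ball 0 R)))"
proof -
  define C where "C = 16 * 64 ^ CARD('n) / unit_ball_vol (real CARD('n)) + 16 * 320 ^ CARD('n)"
  have C: "C > 0"
    by (auto simp: C_def intro!: add_pos_pos divide_pos_pos)
  have "ennreal (measure lebesgue (E \<inter> ball 0 R) powr ((real CARD('n) - 1) / real CARD('n)))
            \<le> ennreal (2 * C * l) * Per r E (ball 0 R)"
    if l: "l \<ge> 1" and R: "R > 0" and r: "r > 0" "l * R \<ge> r" and E: "E \<in> sets lebesgue"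
      and half: "measure lebesgue (E \<inter> ball 0 R) / measure lebesgue (ball (0 :: real ^ 'n) R) \<le> 1 / 2"
    for l R r :: real and E :: "(real ^ 'n) set"
  proof -
    define s where "s = min r R"
    have s: "0 < s" "s \<le> R" "s \<le> r" "r \<le> l * s"
      using l R r mult_right_mono[OF l, of r] by (auto simp: s_def min_def)
    let ?F = "\<lambda>r. fattening (density_boundary E) r \<inter> ball 0 R"
    have F: "?F t \<in> lmeasurable" for t
      by (auto simp: open_fattening intro!: bounded_set_imp_lmeasurable)
    have "measure lebesgue (E \<inter> ball 0 R) \<le> measure lebesgue (ball (0 :: real ^ 'n) R) / 2"
      using half content_ball_pos[OF R, of "0 :: real ^ 'n"] by (simp add: field_simps)
    then have "measure lebesgue (E \<inter> ball 0 R) powr ((real CARD('n) - 1) / real CARD('n))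
        \<le> C / s * measure lebesgue (?F s)"
      using relative_isoperimetric_ball[OF E _ s(1,2)] by (simp add: C_def)
    also have "\<dots> \<le> C / s * measure lebesgue (?F r)"
      using C s F fattening_mono[OF s(3)]
      by (intro mult_left_mono measure_mono_fmeasurable) (auto simp: fmeasurableD)
    also have "\<dots> \<le> C * l / r * measure lebesgue (?F r)"
      using C s r by (intro mult_right_mono) (auto simp: field_simps)
    also have "\<dots> = 2 * C * l * (measure lebesgue (?F r) / (2 * r))"
      using r by (simp add: field_simps)
    finally have "ennreal (measure lebesgue (E \<inter> ball 0 R) powr ((real CARD('n) - 1) / real CARD('n)))
        \<le> ennreal (2 * C * l * (measure lebesgue (?F r) / (2 * r)))"
      by (rule ennreal_leI)
    also have "\<dots> = ennreal (2 * C * l) * ennreal (measure lebesgue (?F r) / (2 * r))"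
      using C l by (intro ennreal_mult') auto
    also have "ennreal (measure lebesgue (?F r) / (2 * r)) = Per r E (ball 0 R)"
      using r F by (simp add: Per_def emeasure_eq_measure2 divide_ennreal)
    finally show ?thesis .
  qed
  then show ?thesis
    using C by (intro exI[of _ "2 * C"]) auto
qed

end
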